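(* For integers $n,m\geq 0$ let $$N_{n,m}(x)=\sum_{k=0}^n \left(\binom{n}{k}\binom{m}{k}-\binom{n}{k+1}\binom{m}{k-1}\right) x^k ,$$ and for $n\geq m+2$ let $r_{n,m}^{+}$ be the unique positive zero of $N_{n,m}(x)$. Then for all integers $m\geq 0$ and $n\geq m+3$, $$r_{n+1,m}^{+}<r_{n,m}^{+}\quad\text{and}\quad r_{n+1,m+1}^{+}<r_{n,m}^{+},$$ and for all integers $m\geq 0$ and $n\geq m+4$, $$r_{n,m}^{+}<r_{n,m+1}^{+}.$$
   Context: Binomial coefficients $\binom{a}{b}$ are taken to be $0$ when $b<0$ or $b>a$. It is known (Chen, Yang and Zhang) that for $m\geq 0$ and $n\geq m+2$ the polynomial $N_{n,m}(x)$ has only real zeros and exactly one positive zero; $r_{n,m}^{+}$ denotes this positive zero. *)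

theory Defs
  imports "HOL-Analysis.Analysis" "HOL-Computational_Algebra.Polynomial"
begin

(* The case split gives (m choose -1) = 0 at k = 0; truncated subtraction would give (m choose 0) = 1. *)
definition N_poly :: "nat \<Rightarrow> nat \<Rightarrow> real poly" where
  "N_poly n m = (\<Sum>k=0..n. monom (real (n choose k) * real (m choose k)
      - real (n choose (k + 1)) * (if k = 0 then 0 else real (m choose (k - 1)))) k)"

(* Meaningful for n \<ge> m + 2, where exactly one positive zero exists (Chen, Yang and Zhang). *)
definition r_plus :: "nat \<Rightarrow> nat \<Rightarrow> real" where
  "r_plus n m = (THE x. x > 0 \<and> poly (N_poly n m) x = 0)"

end

theory Submission
  imports Defs
begin

text \<open>
  Put \<open>P(a, b) = \<Sum>k. (a choose (k + 1)) * (b choose k) * x ^ k\<close> and \<open>d = n - m\<close>. Then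
  \<open>(n + 1) * N(n, m) = d * P(n + 1, m) - (d - 1) * P(n + 1, m + 1)\<close>, and the coefficient of \<open>x ^ k\<close>
  in \<open>N(n, m)\<close> has the sign of \<open>m + 1 - k * d\<close>, so \<open>N(n, m)\<close> is positive before its positive zero
  and negative after it. Since \<open>P\<close> is a hypergeometric polynomial \<open>F(1 - a, -b; 2; x)\<close> up to a
  factor, its contiguous relations express
  \<open>N(n + 1, m + 1)\<close> and \<open>N(n, m + 1)\<close> as a nonnegative multiple (for \<open>0 < x \<le> 1\<close>) of \<open>N(n, m)\<close>
  plus \<open>P(n + 1, m + 1)\<close> times an explicit linear function of \<open>x\<close>. Hence, with \<open>r\<close> the zero of
  \<open>N(n, m)\<close>, the inequality \<open>r(n + 1, m + 1) < r\<close> amounts to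
  \<open>r > 2 * (n + 1) / ((d - 1) * (2 * (m + 1) * (d - 1) + d\<^sup>2))\<close> and \<open>r < r(n, m + 1)\<close> to
  \<open>r < 2 / ((d - 1) * (d - 2))\<close>. Both bounds follow by induction on \<open>m\<close> for fixed \<open>d\<close> from the same
  identities, the second in the sharper form \<open>r \<le> 2 / (d * (d - 1))\<close>. The remaining inequality
  combines these two: \<open>r(n + 1, m) < r(n + 1, m + 1) < r(n, m)\<close>.
\<close>

section \<open>Auxiliary polynomials \<open>P_poly\<close> and the coefficients of
  \<open>N_poly\<close>\<close>

definition P_poly :: "nat \<Rightarrow> nat \<Rightarrow> real poly" where
  "P_poly a b = (\<Sum>k\<le>b. monom (real (a choose (k + 1)) * real (b choose k)) k)"

lemma coeff_P_poly: "coeff (P_poly a b) k = real (a choose (k + 1)) * real (b choose k)"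
  by (auto simp: P_poly_def coeff_sum coeff_monom sum.delta not_le binomial_eq_0)

lemma coeff_N_poly:
  "coeff (N_poly n m) k = real (n choose k) * real (m choose k)
      - real (n choose (k + 1)) * (if k = 0 then 0 else real (m choose (k - 1)))"
  by (auto simp: N_poly_def coeff_sum coeff_monom sum.delta not_le binomial_eq_0)

lemma real_binomial_Suc: "(real k + 1) * real (n choose Suc k) = (real n - real k) * real (n choose k)"
proof (cases "k \<le> n")
  case True
  have "Suc k * (n choose Suc k) = (n - k) * (n choose k)"
    by (metis binomial_absorb_comp binomial_absorption mult.commute)
  then have "real (Suc k * (n choose Suc k)) = real ((n - k) * (n choose k))"
    by presburger
  then show ?thesis
    using True by (simp add: of_nat_diff algebra_simps)
qed (simp add: binomial_eq_0)

lemma real_binomial_absorb_comp: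
  "(real n + 1) * real (n choose k) = (real n + 1 - real k) * real (Suc n choose k)"
proof (cases k)
  case (Suc j)
  then show ?thesis
    using real_binomial_Suc[of j n] by (simp add: algebra_simps)
qed simp

lemma real_binomial_absorption:
  "(real n + 1) * real (n choose k) = (real k + 1) * real (Suc n choose Suc k)"
  using real_binomial_Suc[of k n] by (simp add: algebra_simps)

lemma poly_P_poly_pos:
  assumes "x > 0" and "a \<ge> 1"
  shows "poly (P_poly a b) x > 0"
proof -
  have "0 < (\<Sum>k\<le>b. real (a choose (k + 1)) * real (b choose k) * x ^ k)"
    by (rule sum_pos2[of _ 0]) (use assms in auto)
  then show ?thesis
    by (simp add: P_poly_def poly_sum poly_monom)
qed

text \<open>Absorption turns each product of binomials into a multiple of
  \<open>(Suc n choose Suc k) * (Suc m choose k)\<close>, and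
  \<open>(k + 1) * (m + 1 - k) - (n - k) * k\<close> collapses to
  \<open>m + 1 - k * (n - m)\<close>. For \<open>n > m\<close> this factor changes sign only once as
  \<open>k\<close> grows.\<close>

lemma N_poly_coeff_eq:
  "(real n + 1) * (real m + 1) * coeff (N_poly n m) k
     = real (Suc n choose Suc k) * real (Suc m choose k) * (real m + 1 - real k * (real n - real m))"
proof (cases k)
  case 0
  then show ?thesis by (simp add: coeff_N_poly algebra_simps)
next
  case (Suc j)
  have 1: "(real n + 1) * real (n choose k) = (real k + 1) * real (Suc n choose Suc k)"
    by (rule real_binomial_absorption)
  have 2: "(real n + 1) * real (n choose Suc k) = (real n - real k) * real (Suc n choose Suc k)"
    using real_binomial_absorb_comp[of n "Suc k"] by simp
  have 3: "(real m + 1) * real (m choose k) = (real m + 1 - real k) * real (Suc m choose k)"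
    by (rule real_binomial_absorb_comp)
  have 4: "(real m + 1) * real (m choose j) = real k * real (Suc m choose k)"
    using real_binomial_absorption[of m j] Suc by (simp add: algebra_simps)
  have "(real n + 1) * (real m + 1) * coeff (N_poly n m) k
      = ((real n + 1) * real (n choose k)) * ((real m + 1) * real (m choose k))
        - ((real n + 1) * real (n choose Suc k)) * ((real m + 1) * real (m choose j))"
    using Suc by (simp add: coeff_N_poly algebra_simps)
  then show ?thesis
    unfolding 1 2 3 4 by (simp add: algebra_simps)
qed

text \<open>With \<open>d = n - m\<close>, multiplying the right-hand coefficients by
  \<open>m + 1\<close> produces the factor
  \<open>d * (m + 1 - k) - (d - 1) * (m + 1) = m + 1 - k * d\<close> of
  \<open>N_poly_coeff_eq\<close>.\<close>

lemma N_poly_eq: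
  "smult (real n + 1) (N_poly n m)
     = smult (real n - real m) (P_poly (Suc n) m) - smult (real n - real m - 1) (P_poly (Suc n) (Suc m))"
    (is "?l = ?r")
proof (rule poly_eqI)
  fix k
  have "(real m + 1) * coeff ?r k = real (Suc n choose Suc k) *
    ((real n - real m) * ((real m + 1) * real (m choose k)) - (real n - real m - 1) * (real m + 1) * real (Suc m choose k))"
    by (simp add: coeff_P_poly algebra_simps del: binomial_Suc_Suc)
  also have "\<dots> = real (Suc n choose Suc k) * real (Suc m choose k) * (real m + 1 - real k * (real n - real m))"
    unfolding real_binomial_absorb_comp[of m k] by (simp add: algebra_simps del: binomial_Suc_Suc)
  also have "\<dots> = (real m + 1) * coeff ?l k"
    unfolding N_poly_coeff_eq[symmetric] by simp
  finally show "coeff ?l k = coeff ?r k"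
    by (metis add.commute mult_left_cancel of_nat_Suc of_nat_neq_0)
qed

lemma poly_N_poly_eq:
  "(real n + 1) * poly (N_poly n m) x
     = (real n - real m) * poly (P_poly (Suc n) m) x
       - (real n - real m - 1) * poly (P_poly (Suc n) (Suc m)) x"
  using arg_cong[OF N_poly_eq[of n m], of "\<lambda>p. poly p x"] by simp

section \<open>Contiguous relations for \<open>P_poly\<close>\<close>

text \<open>Writing the binomials in \<open>m\<close> as multiples of \<open>Suc m choose k\<close>
  leaves an identity in \<open>a choose k\<close> and \<open>a choose Suc k\<close>, which is
  Pascal's rule times \<open>a\<close>. The factor \<open>1 - x\<close> mixes neighbouring
  coefficients, hence the case split on \<open>k\<close>.\<close>

lemma P_poly_Suc_left:
  "smult (real a) (P_poly (Suc a) (Suc m))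
     = smult (real a + real m + 2) (P_poly a (Suc m)) - smult (real m + 1) ([:1, -1:] * P_poly a m)"
    (is "?l = ?r")
proof (rule poly_eqI)
  fix k
  have 1: "(real m + 1) * real (m choose k) = (real m + 1 - real k) * real (Suc m choose k)"
    by (rule real_binomial_absorb_comp)
  have 2: "(real k + 1) * real (a choose Suc k) = (real a - real k) * real (a choose k)"
    by (rule real_binomial_Suc)
  show "coeff ?l k = coeff ?r k"
  proof (cases k)
    case 0
    then show ?thesis by (simp add: coeff_P_poly algebra_simps)
  next
    case (Suc j)
    have 3: "(real m + 1) * real (m choose j) = real k * real (Suc m choose k)"
      using real_binomial_absorption[of m j] Suc by (simp add: algebra_simps)
    have "coeff ?r k = (real a + real m + 2) * real (a choose Suc k) * real (Suc m choose k)
        - real (a choose Suc k) * ((real m + 1) * real (m choose k))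
        + real (a choose k) * ((real m + 1) * real (m choose j))"
      using Suc by (simp add: coeff_P_poly algebra_simps del: binomial_Suc_Suc)
    also have "\<dots> = real (Suc m choose k) *
        (real a * real (a choose Suc k) + (real k + 1) * real (a choose Suc k) + real k * real (a choose k))"
      unfolding 1 3 by (simp add: algebra_simps del: binomial_Suc_Suc)
    also have "\<dots> = real (Suc m choose k) * (real a * (real (a choose k) + real (a choose Suc k)))"
      unfolding 2 by (simp add: algebra_simps del: binomial_Suc_Suc)
    also have "\<dots> = coeff ?l k"
      by (simp add: coeff_P_poly)
    finally show ?thesis ..
  qed
qed

text \<open>Mirror image of the previous argument: the binomials in \<open>a\<close> become
  multiples of \<open>Suc a choose Suc k\<close>, and Pascal's rule is applied in
  \<open>b\<close>.\<close>

lemma P_poly_Suc_Suc: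
  "smult (real b + 2) (P_poly (Suc a) (Suc b))
     = smult (real a + real b + 2) (P_poly (Suc a) b) - smult (real a + 1) ([:1, -1:] * P_poly a b)"
    (is "?l = ?r")
proof (rule poly_eqI)
  fix k
  have 1: "(real a + 1) * real (a choose Suc k) = (real a - real k) * real (Suc a choose Suc k)"
    using real_binomial_absorb_comp[of a "Suc k"] by simp
  have 2: "(real a + 1) * real (a choose k) = (real k + 1) * real (Suc a choose Suc k)"
    by (rule real_binomial_absorption)
  show "coeff ?l k = coeff ?r k"
  proof (cases k)
    case 0
    then show ?thesis by (simp add: coeff_P_poly algebra_simps)
  next
    case (Suc j)
    have 3: "real k * real (b choose k) = (real b - real j) * real (b choose j)"
      using real_binomial_Suc[of j b] Suc by (simp add: algebra_simps)
    have "coeff ?r k = (real a + real b + 2) * real (Suc a choose Suc k) * real (b choose k)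
        - ((real a + 1) * real (a choose Suc k)) * real (b choose k)
        + ((real a + 1) * real (a choose k)) * real (b choose j)"
      using Suc by (simp add: coeff_P_poly algebra_simps del: binomial_Suc_Suc)
    also have "\<dots> = real (Suc a choose Suc k) *
        ((real b + 2) * real (b choose k) + real k * real (b choose k) + (real k + 1) * real (b choose j))"
      unfolding 1 2 by (simp add: algebra_simps del: binomial_Suc_Suc)
    also have "\<dots> = real (Suc a choose Suc k) * ((real b + 2) * (real (b choose j) + real (b choose k)))"
      unfolding 3 using Suc by (simp add: algebra_simps del: binomial_Suc_Suc)
    also have "\<dots> = coeff ?l k"
      using Suc by (simp add: coeff_P_poly)
    finally show ?thesis ..
  qed
qed

lemma P_poly_Suc_right:
  "smult (real m + 3) (P_poly a (Suc (Suc m)))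
     = [:2 * real m + 4, real a - real m - 2:] * P_poly a (Suc m)
       - smult (real m + 1) ([:1, -1:] * P_poly a m)"
    (is "?l = ?r")
proof (rule poly_eqI)
  fix k
  have 1: "(real m + 1) * real (m choose k) = (real m + 1 - real k) * real (Suc m choose k)"
    by (rule real_binomial_absorb_comp)
  have 2: "(real k + 1) * real (a choose Suc k) = (real a - real k) * real (a choose k)"
    by (rule real_binomial_Suc)
  show "coeff ?l k = coeff ?r k"
  proof (cases k)
    case 0
    then show ?thesis by (simp add: coeff_P_poly algebra_simps)
  next
    case (Suc j)
    have 3: "(real m + 1) * real (m choose j) = real k * real (Suc m choose k)"
      using real_binomial_absorption[of m j] Suc by (simp add: algebra_simps)
    have 4: "real k * real (Suc m choose k) = (real m + 1 - real j) * real (Suc m choose j)"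
      using real_binomial_Suc[of j "Suc m"] Suc by (simp add: algebra_simps)
    \<comment> \<open>The relations \<open>AB\<close> and \<open>CD\<close> leave only the products
      \<open>A * C\<close> and \<open>A * D\<close>, with common factor \<open>m + 3\<close>;
      Pascal's rule identifies \<open>C + D\<close> with
      \<open>Suc (Suc m) choose k\<close>.\<close>
    define A B where "A = real (a choose Suc k)" and "B = real (a choose k)"
    define C D where "C = real (Suc m choose k)" and "D = real (Suc m choose j)"
    have k: "real k = real j + 1"
      using Suc by simp
    have AB: "(real k + 1) * A = (real a - real k) * B"
      using 2 by (simp add: A_def B_def)
    have CD: "real k * C = (real m + 1 - real j) * D"
      using 4 by (simp add: C_def D_def)
    have "coeff ?r k = (2 * real m + 4) * A * C
        + (real a - real m - 2) * B * D
        - A * ((real m + 1) * real (m choose k))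
        + B * ((real m + 1) * real (m choose j))"
      using Suc by (simp add: coeff_P_poly A_def B_def C_def D_def algebra_simps del: binomial_Suc_Suc)
    also have "\<dots> = (real m + 3) * A * C + (real k * C) * A + (real a - real m - 2) * B * D + B * (real k * C)"
      unfolding 1 3 by (simp add: C_def algebra_simps del: binomial_Suc_Suc)
    also have "\<dots> = (real m + 3) * A * C + (real m + 2 - real k) * D * A + ((real a - real k) * B) * D"
      unfolding CD using k by (simp add: algebra_simps)
    also have "\<dots> = (real m + 3) * A * (C + D)"
      unfolding AB[symmetric] by (simp add: algebra_simps)
    also have "\<dots> = coeff ?l k"
      using Suc by (simp add: coeff_P_poly A_def C_def D_def)
    finally show ?thesis ..
  qed
qed

section \<open>Sign change of \<open>N_poly\<close> and its positive zero\<close>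

text \<open>Descartes' rule for one sign change: \<open>(y / x) ^ k\<close> is at most \<open>(y / x) ^ K\<close> where the
  coefficients are nonnegative and at least that where they are nonpositive.\<close>

lemma poly_neg_of_one_sign_change:
  fixes p :: "real poly"
  assumes nonneg: "\<And>k. k \<le> K \<Longrightarrow> coeff p k \<ge> 0"
    and nonpos: "\<And>k. k > K \<Longrightarrow> coeff p k \<le> 0"
    and j: "j \<noteq> K" "coeff p j \<noteq> 0"
    and xy: "0 < x" "x < y"
    and px: "poly p x \<le> 0"
  shows "poly p y < 0"
proof -
  define q where "q = y / x"
  have q: "q > 1" "y = q * x"
    using xy by (simp_all add: q_def)
  have le: "coeff p i * q ^ i \<le> coeff p i * q ^ K" for i
  proof (cases "i \<le> K")
    case True
    then show ?thesis using q nonneg by (intro mult_left_mono power_increasing) auto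
  next
    case False
    then show ?thesis using q nonpos by (intro mult_left_mono_neg power_increasing) auto
  qed
  have "coeff p j * q ^ j \<noteq> coeff p j * q ^ K"
    using j q by simp
  with le[of j] have less: "coeff p j * q ^ j < coeff p j * q ^ K"
    by (rule le_neq_trans)
  have "poly p y = (\<Sum>i\<le>degree p. coeff p i * q ^ i * x ^ i)"
    by (simp add: poly_altdef q power_mult_distrib mult.assoc)
  also have "\<dots> < (\<Sum>i\<le>degree p. coeff p i * q ^ K * x ^ i)"
  proof (rule sum_strict_mono_ex1)
    show "\<forall>i\<in>{..degree p}. coeff p i * q ^ i * x ^ i \<le> coeff p i * q ^ K * x ^ i"
      using le xy by (simp add: mult_right_mono)
    show "\<exists>i\<in>{..degree p}. coeff p i * q ^ i * x ^ i < coeff p i * q ^ K * x ^ i"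
      using less j xy by (intro bexI[of _ j] mult_strict_right_mono) (auto simp: le_degree)
  qed simp
  also have "\<dots> = q ^ K * poly p x"
    by (simp add: poly_altdef sum_distrib_left mult_ac)
  also have "\<dots> \<le> 0"
    using px q by (simp add: mult_nonneg_nonpos)
  finally show ?thesis .
qed

lemma N_poly_neg_mono:
  assumes "n \<ge> m + 2" and "0 < x" "x < y" and "poly (N_poly n m) x \<le> 0"
  shows "poly (N_poly n m) y < 0"
proof -
  define K where "K = (m + 1) div (n - m)"
  have pos: "(real n + 1) * (real m + 1) > 0"
    by simp
  have coeff: "coeff (N_poly n m) k = real (Suc n choose Suc k) * real (Suc m choose k)
      * (real m + 1 - real k * (real n - real m)) / ((real n + 1) * (real m + 1))" for k
    using N_poly_coeff_eq[of n m k] pos by (simp add: field_simps del: binomial_Suc_Suc)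
  have sgn: "real m + 1 - real k * (real n - real m) \<ge> 0 \<longleftrightarrow> k \<le> K" for k
  proof -
    have "k \<le> K \<longleftrightarrow> k * (n - m) \<le> m + 1"
      unfolding K_def using assms(1) by (simp add: less_eq_div_iff_mult_less_eq)
    also have "\<dots> \<longleftrightarrow> real (k * (n - m)) \<le> real (m + 1)"
      by (simp only: of_nat_le_iff)
    also have "\<dots> \<longleftrightarrow> real m + 1 - real k * (real n - real m) \<ge> 0"
      using assms(1) by (simp add: of_nat_diff algebra_simps)
    finally show ?thesis by simp
  qed
  \<comment> \<open>Strictness requires a nonzero coefficient away from \<open>K\<close>. The
    coefficients at 0 and at \<open>Suc m\<close> are both nonzero, and at least one of these
    indices differs from \<open>K\<close>.\<close>
  have c0: "coeff (N_poly n m) 0 \<noteq> 0"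
    unfolding coeff by simp
  have "(real m + 1) * 2 \<le> (real m + 1) * (real n - real m)"
    using assms(1) by (intro mult_left_mono) auto
  then have "real m + 1 - real (Suc m) * (real n - real m) \<noteq> 0"
    by (simp add: algebra_simps)
  moreover have "Suc n choose Suc (Suc m) \<noteq> 0"
    using assms(1) by (simp add: binomial_eq_0_iff del: binomial_Suc_Suc)
  ultimately have c1: "coeff (N_poly n m) (Suc m) \<noteq> 0"
    unfolding coeff using pos by (simp del: binomial_Suc_Suc)
  obtain j where j: "j \<noteq> K" "coeff (N_poly n m) j \<noteq> 0"
    using c0 c1 by (metis nat.distinct(1))
  show ?thesis
  proof (rule poly_neg_of_one_sign_change[OF _ _ j assms(2-4)])
    show "coeff (N_poly n m) k \<ge> 0" if "k \<le> K" for k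
      unfolding coeff using sgn[of k] that by (intro divide_nonneg_nonneg mult_nonneg_nonneg) auto
    show "coeff (N_poly n m) k \<le> 0" if "k > K" for k
      unfolding coeff using sgn[of k] that
      by (intro divide_nonpos_nonneg mult_nonneg_nonpos) auto
  qed
qed

text \<open>Of two distinct positive zeros, the smaller would force a negative value at the
  larger.\<close>

lemma r_plus_unique:
  assumes "n \<ge> m + 2" "x > 0" "poly (N_poly n m) x = 0"
  shows "r_plus n m = x"
  unfolding r_plus_def
proof (rule the_equality)
  fix y assume y: "y > 0 \<and> poly (N_poly n m) y = 0"
  show "y = x"
    using N_poly_neg_mono[of m n x y] N_poly_neg_mono[of m n y x] assms y
    by (cases x y rule: linorder_cases) auto
qed (use assms in auto)

text \<open>Since \<open>N_poly\<close> is 1 at 0, the intermediate value theorem applies: a single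
  nonpositive value yields both the existence of the zero and an upper bound for it.\<close>

lemma r_plus_if_nonpos:
  assumes "n \<ge> m + 2" "x > 0" "poly (N_poly n m) x \<le> 0"
  shows "0 < r_plus n m" "r_plus n m \<le> x" "poly (N_poly n m) (r_plus n m) = 0"
proof -
  have "poly (N_poly n m) 0 = 1"
    by (simp add: poly_0_coeff_0 coeff_N_poly)
  moreover have "continuous_on {0..x} (poly (N_poly n m))"
    by (intro continuous_on_poly continuous_on_id)
  ultimately obtain z where z: "0 \<le> z" "z \<le> x" "poly (N_poly n m) z = 0"
    using IVT2'[of "poly (N_poly n m)" x 0 0] assms by auto
  with \<open>poly (N_poly n m) 0 = 1\<close> have "z > 0"
    by (cases "z = 0") auto
  with r_plus_unique[of m n z] assms z
  show "0 < r_plus n m" "r_plus n m \<le> x" "poly (N_poly n m) (r_plus n m) = 0"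
    by auto
qed

section \<open>Recurrences for \<open>N_poly\<close> along the diagonal and in
  \<open>m\<close>\<close>

text \<open>Reduces the two recurrences below to division-free identities that
  \<open>algebra\<close> can decide.\<close>

lemma eq_add_divide:
  fixes d :: "'a :: field"
  assumes "d \<noteq> 0" and "d * s = a * t + u"
  shows "s = a / d * t + u / d"
  using assms by (simp add: field_simps)

text \<open>The diagonal step preserves \<open>d\<close>. The contiguous relations express the new
  values \<open>X\<close> and \<open>Y\<close> through \<open>p\<close> and \<open>q\<close>, and
  then \<open>q\<close> is traded for \<open>N_poly n m\<close>.\<close>

lemma poly_N_poly_diagonal_step:
  fixes n m :: nat and d x :: real
  defines "p \<equiv> poly (P_poly (Suc n) (Suc m)) x"
  assumes d_def: "d = real n - real m" and "d \<noteq> 0"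
  shows "(real m + 3) * (real n + 1) * poly (N_poly (Suc n) (Suc m)) x
    = (d - 2) * (real m + 1) * (1 - x) / d * ((real n + 1) * poly (N_poly n m) x)
      + p * (2 * (real n + 1) - (d - 1) * (2 * (real m + 1) * (d - 1) + d\<^sup>2) * x) / d"
proof -
  define q X Y where "q = poly (P_poly (Suc n) m) x"
    and "X = poly (P_poly (Suc (Suc n)) (Suc m)) x"
    and "Y = poly (P_poly (Suc (Suc n)) (Suc (Suc m))) x"
  have n: "real n = d + real m"
    by (simp add: d_def)
  have X: "(real n + 1) * X = (real n + real m + 3) * p - (real m + 1) * (1 - x) * q"
    using arg_cong[OF P_poly_Suc_left[of "Suc n" m], of "\<lambda>p. poly p x"]
    by (simp add: X_def p_def q_def algebra_simps)
  have Y: "(real m + 3) * Y = (real n + real m + 4) * X - (real n + 2) * (1 - x) * p"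
    using arg_cong[OF P_poly_Suc_Suc[of "Suc m" "Suc n"], of "\<lambda>p. poly p x"]
    by (simp add: X_def Y_def p_def algebra_simps)
  have N: "(real n + 1) * poly (N_poly n m) x = d * q - (d - 1) * p"
    using poly_N_poly_eq[of n m x] by (simp add: d_def p_def q_def)
  have N': "(real n + 2) * poly (N_poly (Suc n) (Suc m)) x = d * X - (d - 1) * Y"
    using poly_N_poly_eq[of "Suc n" "Suc m" x] by (simp add: d_def X_def Y_def algebra_simps)
  define V where "V = poly (N_poly (Suc n) (Suc m)) x"
  have "(real n + 2) * ((real m + 3) * (real n + 1) * V)
      = (real n + 1) * ((real m + 3) * d * X - (d - 1) * ((real m + 3) * Y))"
    using N' unfolding V_def by algebra
  \<comment> \<open>Since \<open>n = d + m\<close>, the coefficient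
    \<open>(m + 3) * d - (d - 1) * (n + m + 4)\<close> of \<open>X\<close> equals
    \<open>- (d - 2) * (n + 2)\<close>, so \<open>n + 2\<close> cancels.\<close>
  also have "\<dots> = (real n + 2) * ((d - 1) * (1 - x) * (real n + 1) * p - (d - 2) * ((real n + 1) * X))"
    unfolding Y n by algebra
  finally have "(real m + 3) * (real n + 1) * V
      = (d - 1) * (1 - x) * (real n + 1) * p - (d - 2) * ((real n + 1) * X)"
    by (simp add: add_nonneg_eq_0_iff)
  also have "\<dots> = (d - 2) * (real m + 1) * (1 - x) / d * (d * q - (d - 1) * p)
      + p * (2 * (real n + 1) - (d - 1) * (2 * (real m + 1) * (d - 1) + d\<^sup>2) * x) / d"
  proof -
    have "d * ((d - 1) * (1 - x) * (real n + 1) * p - (d - 2) * ((real n + 1) * X))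
        = (d - 2) * (real m + 1) * (1 - x) * (d * q - (d - 1) * p) + p * (2 * (real n + 1) - (d - 1) * (2 * (real m + 1) * (d - 1) + d\<^sup>2) * x)"
      unfolding X unfolding n by algebra
    then show ?thesis
      by (rule eq_add_divide[OF \<open>d \<noteq> 0\<close>])
  qed
  finally show ?thesis
    unfolding N V_def .
qed

text \<open>Here \<open>d\<close> drops by 1 and \<open>Suc n\<close> stays fixed, so the three-term
  relation \<open>P_poly_Suc_right\<close> alone removes \<open>Y\<close>.\<close>

lemma poly_N_poly_right_step:
  fixes n m :: nat and d x :: real
  defines "p \<equiv> poly (P_poly (Suc n) (Suc m)) x"
  assumes d_def: "d = real n - real m" and "d \<noteq> 0"
  shows "(real m + 3) * (real n + 1) * poly (N_poly n (Suc m)) x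
    = (d - 2) * (real m + 1) * (1 - x) / d * ((real n + 1) * poly (N_poly n m) x)
      + p * (real n + 1) * (2 - (d - 1) * (d - 2) * x) / d"
proof -
  define q Y where "q = poly (P_poly (Suc n) m) x"
    and "Y = poly (P_poly (Suc n) (Suc (Suc m))) x"
  have n: "real n = d + real m"
    by (simp add: d_def)
  have Y: "(real m + 3) * Y = (2 * real m + 4 + (d - 1) * x) * p - (real m + 1) * (1 - x) * q"
    using arg_cong[OF P_poly_Suc_right[of m "Suc n"], of "\<lambda>p. poly p x"]
    by (simp add: Y_def p_def q_def d_def algebra_simps)
  have N: "(real n + 1) * poly (N_poly n m) x = d * q - (d - 1) * p"
    using poly_N_poly_eq[of n m x] by (simp add: d_def p_def q_def)
  have N': "(real n + 1) * poly (N_poly n (Suc m)) x = (d - 1) * p - (d - 2) * Y"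
    using poly_N_poly_eq[of n "Suc m" x] by (simp add: d_def p_def Y_def algebra_simps)
  have "(real m + 3) * (real n + 1) * poly (N_poly n (Suc m)) x
      = (real m + 3) * (d - 1) * p - (d - 2) * ((real m + 3) * Y)"
    using N' by algebra
  also have "\<dots> = (d - 2) * (real m + 1) * (1 - x) / d * (d * q - (d - 1) * p)
      + p * (real n + 1) * (2 - (d - 1) * (d - 2) * x) / d"
  proof -
    have "d * ((real m + 3) * (d - 1) * p - (d - 2) * ((real m + 3) * Y))
        = (d - 2) * (real m + 1) * (1 - x) * (d * q - (d - 1) * p) + p * (real n + 1) * (2 - (d - 1) * (d - 2) * x)"
      unfolding Y unfolding n by algebra
    then show ?thesis
      by (rule eq_add_divide[OF \<open>d \<noteq> 0\<close>])
  qed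
  finally show ?thesis
    unfolding N .
qed

lemma poly_N_poly_0: "poly (N_poly n 0) x = 1 - real n * (real n - 1) / 2 * x"
proof -
  have "N_poly n 0 = [:1, - real (n choose 2):]"
    by (rule poly_eqI)
      (auto simp: coeff_N_poly coeff_pCons binomial_eq_0 numeral_2_eq_2 split: nat.splits)
  moreover have "real (n choose 2) = real n * (real n - 1) / 2"
    by (cases n) (simp_all add: choose_two real_of_nat_div algebra_simps)
  ultimately show ?thesis
    by simp
qed

section \<open>Upper and lower bounds for the positive zero\<close>

text \<open>The point is the exact zero in the base case \<open>m = 0\<close> and depends only on
  \<open>d\<close>, so it stays fixed during the induction along the diagonal.\<close>

lemma N_poly_nonpos:
  assumes "n \<ge> m + 3"
  shows "poly (N_poly n m) (2 / ((real n - real m) * (real n - real m - 1))) \<le> 0"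
  using assms
proof (induction m arbitrary: n)
  case 0
  then show ?case
    by (simp add: poly_N_poly_0 field_simps)
next
  case (Suc m)
  then obtain n' where n': "n = Suc n'" "n' \<ge> m + 3"
    by (cases n) auto
  define d x where "d = real n' - real m" and "x = 2 / (d * (d - 1))"
  have d: "d \<ge> 3" "real n' = d + real m"
    using n' by (auto simp: d_def)
  have "d * (d - 1) \<ge> 3 * 2"
    using d by (intro mult_mono) auto
  then have x: "0 < x" "x \<le> 1"
    using d by (auto simp: x_def)
  have xd: "(d - 1) * x * d = 2"
    using d by (auto simp: x_def field_simps)
  have "d * (2 * (real n' + 1) - (d - 1) * (2 * (real m + 1) * (d - 1) + d\<^sup>2) * x)
      = 2 * d * (real n' + 1) - (2 * (real m + 1) * (d - 1) + d\<^sup>2) * ((d - 1) * x * d)"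
    by (simp add: algebra_simps)
  also have "\<dots> = - 2 * (real m + 1) * (d - 2)"
    unfolding xd d(2) by (simp add: algebra_simps power2_eq_square)
  also have "\<dots> \<le> 0"
    using d by (intro mult_nonpos_nonneg) auto
  finally have lin: "2 * (real n' + 1) - (d - 1) * (2 * (real m + 1) * (d - 1) + d\<^sup>2) * x \<le> 0"
    using d by (simp add: mult_le_0_iff)
  have "poly (N_poly n' m) x \<le> 0"
    using Suc.IH[OF n'(2)] by (simp add: x_def d_def)
  moreover have "poly (P_poly (Suc n') (Suc m)) x > 0"
    using x by (simp add: poly_P_poly_pos)
  ultimately have "(real m + 3) * (real n' + 1) * poly (N_poly n (Suc m)) x \<le> 0"
    unfolding n'(1) using d x lin
    by (subst poly_N_poly_diagonal_step[OF d_def])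
       (auto intro!: add_nonpos_nonpos divide_nonpos_nonneg mult_nonneg_nonpos)
  then have "poly (N_poly n (Suc m)) x \<le> 0"
    by (simp add: mult_le_0_iff)
  then show ?case
    by (simp add: x_def d_def n'(1))
qed

text \<open>The bound on \<open>x\<close> says that the linear factor in the diagonal step from
  \<open>(n, m)\<close> is nonnegative. For fixed \<open>d\<close> the bound at \<open>Suc m\<close>
  implies the one at \<open>m\<close>, which serves both the induction hypothesis and the remainder
  term.\<close>

lemma N_poly_pos:
  assumes "n \<ge> m + 3" and "x > 0"
    and "(real n - real m - 1) * (2 * (real m + 1) * (real n - real m - 1) + (real n - real m)\<^sup>2) * x
      \<le> 2 * (real n + 1)"
  shows "poly (N_poly n m) x > 0"
  using assms
proof (induction m arbitrary: n)
  case 0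
  define d where "d = real n"
  have d: "d \<ge> 3"
    using 0 by (simp add: d_def)
  \<comment> \<open>Otherwise the hypothesis multiplied by \<open>d\<close> would give
    \<open>2 * (2 * (d - 1) + d^2) <= 2 * d * (d + 1)\<close>, that is
    \<open>d <= 2\<close>.\<close>
  have "d * (d - 1) * x < 2"
  proof (rule ccontr)
    assume *: "\<not> d * (d - 1) * x < 2"
    have "(2 * (d - 1) + d\<^sup>2) * 2 \<le> (2 * (d - 1) + d\<^sup>2) * (d * (d - 1) * x)"
      using * d by (intro mult_left_mono) auto
    also have "\<dots> = d * ((d - 1) * (2 * (d - 1) + d\<^sup>2) * x)"
      by (simp add: algebra_simps)
    also have "\<dots> \<le> d * (2 * (d + 1))"
      using 0 d by (intro mult_left_mono) (auto simp: d_def)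
    finally show False
      using d by (simp add: algebra_simps power2_eq_square)
  qed
  then show ?case
    by (simp add: poly_N_poly_0 d_def)
next
  case (Suc m)
  then obtain n' where n': "n = Suc n'" "n' \<ge> m + 3"
    by (cases n) auto
  define d y where "d = real n' - real m" and "y = (d - 1) * x"
  define b where "b = real m + 1"
  have d: "d \<ge> 3" "real n' + 1 = d + b" "b > 0"
    using n' by (auto simp: d_def b_def)
  have y: "y > 0"
    using d \<open>x > 0\<close> by (simp add: y_def)
  have prem: "y * (2 * (d - 1)) + y * (2 * b * (d - 1) + d\<^sup>2) \<le> 2 * (b + d) + 2"
    using Suc.prems(3) d(2) unfolding n'(1) by (simp add: y_def d_def b_def algebra_simps)
  \<comment> \<open>Compared with this goal, \<open>prem\<close> has the extra terms
    \<open>y * (2 * (d - 1))\<close> on the left and 2 on the right. If the goal failed, the former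
    would be less than the latter; multiplying by \<open>b + d\<close> and using
    \<open>d^2 <= 2 * d * (d - 1)\<close> would then give the goal.\<close>
  have le: "y * (2 * b * (d - 1) + d\<^sup>2) \<le> 2 * (b + d)"
  proof (rule ccontr)
    assume *: "\<not> ?thesis"
    with prem have 1: "y * (2 * (d - 1)) < 2"
      by linarith
    have "y * (2 * b * (d - 1) + d\<^sup>2) \<le> y * (2 * b * (d - 1) + d * (2 * (d - 1)))"
      using y d by (intro mult_left_mono) (auto simp: power2_eq_square)
    also have "\<dots> = (b + d) * (y * (2 * (d - 1)))"
      by (simp add: algebra_simps)
    also have "\<dots> \<le> (b + d) * 2"
      using 1 d by (intro mult_left_mono) auto
    finally show False
      using * by simp
  qed
  \<comment> \<open>Makes the factor \<open>1 - x\<close> in the diagonal step positive.\<close>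
  have x1: "x < 1"
  proof (rule ccontr)
    assume "\<not> x < 1"
    then have "y \<ge> (d - 1) * 1"
      unfolding y_def using d by (intro mult_left_mono) auto
    then have "y \<ge> 2"
      using d by simp
    have "b * 1 \<le> b * (2 * (d - 1))"
      using d by (intro mult_left_mono) auto
    moreover have "d * 1 < d * d"
      using d by (intro mult_strict_left_mono) auto
    ultimately have "2 * (b + d) < 2 * (2 * b * (d - 1) + d\<^sup>2)"
      by (simp add: power2_eq_square algebra_simps)
    also have "\<dots> \<le> y * (2 * b * (d - 1) + d\<^sup>2)"
      using \<open>y \<ge> 2\<close> d by (intro mult_right_mono) auto
    finally show False
      using le by simp
  qed
  have lin: "(d - 1) * (2 * (real m + 1) * (d - 1) + d\<^sup>2) * x \<le> 2 * (real n' + 1)"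
    using le d(2) by (simp add: y_def b_def algebra_simps)
  have pos: "poly (N_poly n' m) x > 0"
    using Suc.IH[OF n'(2) \<open>x > 0\<close>] lin by (simp add: d_def)
  have "poly (P_poly (Suc n') (Suc m)) x > 0"
    using \<open>x > 0\<close> by (simp add: poly_P_poly_pos)
  then have "(real m + 3) * (real n' + 1) * poly (N_poly n (Suc m)) x > 0"
    unfolding n'(1) using d x1 pos lin
    by (subst poly_N_poly_diagonal_step[OF d_def], simp, intro add_pos_nonneg) auto
  then show ?case
    by (rule zero_less_mult_pos) simp
qed

lemma r_plus_bounds:
  assumes "n \<ge> m + 3"
  defines "d \<equiv> real n - real m"
  shows "0 < r_plus n m" "poly (N_poly n m) (r_plus n m) = 0"
    and "r_plus n m \<le> 2 / (d * (d - 1))"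
    and "2 * (real n + 1) < (d - 1) * (2 * (real m + 1) * (d - 1) + d\<^sup>2) * r_plus n m"
proof -
  have "d \<ge> 3"
    using assms by simp
  then have "0 < 2 / (d * (d - 1))"
    by simp
  then show *: "0 < r_plus n m" "poly (N_poly n m) (r_plus n m) = 0" "r_plus n m \<le> 2 / (d * (d - 1))"
    using r_plus_if_nonpos[of m n "2 / (d * (d - 1))"] N_poly_nonpos[OF assms(1)] assms
    by auto
  show "2 * (real n + 1) < (d - 1) * (2 * (real m + 1) * (d - 1) + d\<^sup>2) * r_plus n m"
    using N_poly_pos[OF assms(1) *(1)] *(2) unfolding d_def by fastforce
qed

section \<open>Comparison of the zeros\<close>

text \<open>At the zero of \<open>N_poly n m\<close> only the \<open>P_poly\<close> term of the
  diagonal step survives, and the lower bound in \<open>r_plus_bounds\<close> makes it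
  negative.\<close>

lemma r_plus_diagonal_less:
  assumes "n \<ge> m + 3"
  shows "r_plus (Suc n) (Suc m) < r_plus n m"
proof -
  define d x where "d = real n - real m" and "x = r_plus n m"
  have d: "d \<ge> 3"
    using assms by (simp add: d_def)
  note x = r_plus_bounds[OF assms, folded d_def x_def]
  have "poly (P_poly (Suc n) (Suc m)) x > 0"
    using x by (simp add: poly_P_poly_pos)
  then have "(real m + 3) * (real n + 1) * poly (N_poly (Suc n) (Suc m)) x < 0"
    using d x by (subst poly_N_poly_diagonal_step[OF d_def])
      (auto intro!: divide_neg_pos mult_pos_neg)
  then have neg: "poly (N_poly (Suc n) (Suc m)) x < 0"
    by (simp add: mult_less_0_iff)
  then have "r_plus (Suc n) (Suc m) \<le> x" "poly (N_poly (Suc n) (Suc m)) (r_plus (Suc n) (Suc m)) = 0"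
    using r_plus_if_nonpos[of "Suc m" "Suc n" x] x assms by auto
  with neg show ?thesis
    unfolding x_def by (metis less_irrefl order_le_less)
qed

lemma r_plus_right_greater:
  assumes "n \<ge> m + 4"
  shows "r_plus n m < r_plus n (Suc m)"
proof -
  define d x where "d = real n - real m" and "x = r_plus n m"
  have d: "d \<ge> 4"
    using assms by (simp add: d_def)
  have "n \<ge> m + 3"
    using assms by simp
  note x = r_plus_bounds[OF this, folded d_def x_def]
  \<comment> \<open>The upper bound on the zero gives \<open>2 * (d - 2) / d\<close>, so the
    surviving term of the right step is positive.\<close>
  have "(d - 1) * (d - 2) * x \<le> (d - 1) * (d - 2) * (2 / (d * (d - 1)))"
    using d x by (intro mult_left_mono) auto
  also have "\<dots> < 2"
    using d by (simp add: field_simps)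
  finally have lin: "(d - 1) * (d - 2) * x < 2" .
  have "poly (P_poly (Suc n) (Suc m)) x > 0"
    using x by (simp add: poly_P_poly_pos)
  then have "(real m + 3) * (real n + 1) * poly (N_poly n (Suc m)) x > 0"
    using d x lin by (subst poly_N_poly_right_step[OF d_def])
      (auto intro!: divide_pos_pos mult_pos_pos)
  then have pos: "poly (N_poly n (Suc m)) x > 0"
    by (rule zero_less_mult_pos) simp
  have n: "n \<ge> Suc m + 3"
    using assms by simp
  note r = r_plus_bounds(1,2)[OF n]
  show ?thesis
  proof (rule ccontr)
    assume "\<not> ?thesis"
    then have "r_plus n (Suc m) \<le> x"
      by (simp add: x_def)
    then show False
      using pos r N_poly_neg_mono[of "Suc m" n "r_plus n (Suc m)" x] n
      by (cases "r_plus n (Suc m) = x") auto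
  qed
qed

theorem theorem4p1:
  shows "(\<forall>m n. n \<ge> m + 3 \<longrightarrow>
            r_plus (n + 1) m < r_plus n m \<and> r_plus (n + 1) (m + 1) < r_plus n m)
       \<and> (\<forall>m n. n \<ge> m + 4 \<longrightarrow> r_plus n m < r_plus n (m + 1))"
proof (intro conjI allI impI)
  fix m n :: nat
  assume n: "n \<ge> m + 3"
  show "r_plus (n + 1) (m + 1) < r_plus n m"
    using r_plus_diagonal_less[OF n] by simp
  moreover have "r_plus (n + 1) m < r_plus (n + 1) (m + 1)"
    using r_plus_right_greater[of m "n + 1"] n by simp
  ultimately show "r_plus (n + 1) m < r_plus n m"
    by simp
next
  fix m n :: nat
  assume "n \<ge> m + 4"
  then show "r_plus n m < r_plus n (m + 1)"
    using r_plus_right_greater by simp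
qed

end
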